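(* For a finite group $G$, the following are equivalent: (i) $\mathcal{P}^{o}(G)=\Delta^o(G)$; (ii) every cyclic subgroup of $G$ has prime power order.
   Context: All graphs are simple and undirected with vertex set $G$; equality of two such graphs means they have the same edge set. The power graph $\mathcal{P}(G)$: two distinct elements are adjacent iff one of them is a positive integral power of the other. The commuting graph $\Delta(G)$: two distinct elements are adjacent iff they commute. Let $o(g)$ denote the order of $g\in G$. For $A\in\{\mathcal{P},\Delta\}$, the order super $A$ graph $A^o(G)$ is the graph on $G$ in which two distinct elements $g,h$ are adjacent iff either $o(g)=o(h)$, or there exist $g',h'\in G$ with $o(g')=o(g)$, $o(h')=o(h)$ such that $g'$ and $h'$ are adjacent in $A(G)$. The trivial subgroup (order $1=p^0$) counts as having prime power order. *)

theory Defs
  imports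
    "HOL-Algebra.Elementary_Groups"
    "HOL-Algebra.Multiplicative_Group"
    "HOL-Computational_Algebra.Primes"
    "Graph_Theory.Pair_Digraph"
begin

text \<open>
  A simple undirected graph is a symmetric loop-free set of ordered pairs over a vertex set
  (locale \<^locale>\<open>pair_graph\<close>), so every edge is represented by both of its orientations, and
  equality of graphs is equality of vertex and edge sets.
\<close>

definition power_graph :: "('a, 'b) monoid_scheme \<Rightarrow> 'a pair_pre_digraph" where
  "power_graph G =
    \<lparr> pverts = carrier G,
      parcs = {(x, y). x \<in> carrier G \<and> y \<in> carrier G \<and> x \<noteq> y \<and>
        ((\<exists>n::nat. n > 0 \<and> x = y [^]\<^bsub>G\<^esub> n) \<or> (\<exists>n::nat. n > 0 \<and> y = x [^]\<^bsub>G\<^esub> n))} \<rparr>"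

definition commuting_graph :: "('a, 'b) monoid_scheme \<Rightarrow> 'a pair_pre_digraph" where
  "commuting_graph G =
    \<lparr> pverts = carrier G,
      parcs = {(x, y). x \<in> carrier G \<and> y \<in> carrier G \<and> x \<noteq> y \<and>
        x \<otimes>\<^bsub>G\<^esub> y = y \<otimes>\<^bsub>G\<^esub> x} \<rparr>"

definition order_super_graph ::
    "('a, 'b) monoid_scheme \<Rightarrow> 'a pair_pre_digraph \<Rightarrow> 'a pair_pre_digraph" where
  "order_super_graph G A =
    \<lparr> pverts = carrier G,
      parcs = {(g, h). g \<in> carrier G \<and> h \<in> carrier G \<and> g \<noteq> h \<and>
        (group.ord G g = group.ord G h \<or>
         (\<exists>g' \<in> carrier G. \<exists>h' \<in> carrier G.
            group.ord G g' = group.ord G g \<and> group.ord G h' = group.ord G h \<and>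
            (g', h') \<in> parcs A))} \<rparr>"

lemma finite_irrefl_pairs:
  "finite V \<Longrightarrow> finite {(x, y). x \<in> V \<and> y \<in> V \<and> x \<noteq> y \<and> P x y}"
  by (rule finite_subset[of _ "V \<times> V"]) auto

lemma pair_graph_power_graph:
  "finite (carrier G) \<Longrightarrow> pair_graph (power_graph G)"
  by unfold_locales
    (auto simp: power_graph_def symmetric_def sym_def finite_irrefl_pairs)

lemma pair_graph_commuting_graph:
  "finite (carrier G) \<Longrightarrow> pair_graph (commuting_graph G)"
  by unfold_locales
    (auto simp: commuting_graph_def symmetric_def sym_def finite_irrefl_pairs)

lemma pair_graph_order_super_graph:
  assumes "finite (carrier G)" and "pair_graph A"
  shows "pair_graph (order_super_graph G A)"
proof -
  interpret A: pair_graph A by fact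
  have sym_A: "(x, y) \<in> parcs A \<longleftrightarrow> (y, x) \<in> parcs A" for x y
    using A.pair_sym_arcs by (auto simp: symmetric_def sym_def)
  have "sym (parcs (order_super_graph G A))"
    unfolding sym_def order_super_graph_def using sym_A by simp metis
  then have "symmetric (order_super_graph G A)"
    by (simp add: symmetric_def)
  with assms(1) show ?thesis
    by unfold_locales (auto simp: order_super_graph_def finite_irrefl_pairs)
qed

end

theory Submission
  imports Defs
begin

text \<open>
  In a finite group every divisor of \<open>o(g)\<close> is the order of a power of \<open>g\<close>, so \<open>g\<close> and \<open>h\<close> are
  adjacent in the order super power graph iff one of \<open>o(g)\<close>, \<open>o(h)\<close> divides the other. Hence (i)
  says that commuting elements have comparable orders. If some \<open>o(x)\<close> has two distinct prime
  divisors, then powers of \<open>x\<close> of these orders violate this. Conversely, commuting elements whose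
  orders are powers of distinct primes have a product whose order is divisible by both of their
  orders; if that order is a prime power as well, then the two orders are comparable.
\<close>

text \<open>Split off the full power of a prime divisor \<open>p\<close>. The cofactor
  \<open>m\<close> is not 1, as \<open>n\<close> would then be a power of \<open>p\<close>; a prime
  divisor \<open>q\<close> of \<open>m\<close> differs from \<open>p\<close> because
  \<open>p\<close> does not divide \<open>m\<close>.\<close>

lemma not_prime_power_obtain_primes:
  fixes n :: nat
  assumes "n > 0" and not_pow: "\<nexists>p k. prime p \<and> n = p ^ k"
  obtains p q where "prime p" "prime q" "p \<noteq> q" "p dvd n" "q dvd n"
proof -
  \<comment> \<open>The exponent 0 is allowed, so 1 counts as the prime power
    \<open>2 ^ 0\<close>.\<close>
  have "n \<noteq> 1"
    using not_pow two_is_prime_nat by (metis power_0)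
  then obtain p where p: "prime p" "p dvd n"
    using prime_factor_nat by blast
  have "\<not> is_unit p" using p by auto
  then obtain m where m: "n = p ^ multiplicity p n * m" "\<not> p dvd m"
    using multiplicity_decompose'[of n p] \<open>n > 0\<close> by auto
  have "m \<noteq> 1"
    using not_pow p m(1) by (metis mult.right_neutral)
  then obtain q where q: "prime q" "q dvd m"
    using prime_factor_nat by blast
  show thesis
    using that[of p q] p q m by (metis dvd_mult)
qed

lemma dvd_prime_power_linear:
  fixes d e r :: nat
  assumes "prime r" "d dvd r ^ k" "e dvd r ^ k"
  shows "d dvd e \<or> e dvd d"
proof -
  obtain i j where "d = r ^ i" "e = r ^ j"
    using assms by (auto simp: divides_primepow_nat)
  then show ?thesis
    using le_imp_power_dvd linear by metis
qed

context group
begin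

text \<open>Raising the product to the power \<open>?n * ord y\<close> kills the factor from
  \<open>y\<close>, so \<open>ord x\<close> divides \<open>?n * ord y\<close>; coprimality then
  removes \<open>ord y\<close>.\<close>

lemma ord_dvd_ord_mult_of_coprime:
  assumes "x \<in> carrier G" "y \<in> carrier G" "x \<otimes> y = y \<otimes> x" "coprime (ord x) (ord y)"
  shows "ord x dvd ord (x \<otimes> y)"
proof -
  let ?n = "ord (x \<otimes> y)"
  have "(x \<otimes> y) [^] (?n * ord y) = \<one>"
    using assms by (simp add: pow_eq_id)
  then have "x [^] (?n * ord y) \<otimes> y [^] (?n * ord y) = \<one>"
    using pow_mult_distrib[OF assms(3,1,2)] by simp
  moreover have "y [^] (?n * ord y) = \<one>"
    using assms by (simp add: pow_eq_id)
  ultimately have "ord x dvd ?n * ord y"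
    using assms(1) by (simp add: pow_eq_id)
  then show ?thesis
    using assms(4) coprime_dvd_mult_left_iff by blast
qed

text \<open>The exponent is the cofactor of \<open>d\<close> in \<open>ord x\<close>. Its positivity
  matters because edges of the power graph need positive exponents.\<close>

lemma ex_pow_of_ord:
  assumes "finite (carrier G)" "x \<in> carrier G" "d dvd ord x"
  obtains k :: nat where "k > 0" "ord (x [^] k) = d"
proof -
  have pos: "ord x > 0"
    using ord_ge_1[OF assms(1,2)] by simp
  obtain k where k: "ord x = d * k"
    using assms(3) by blast
  then have "k > 0" "d > 0"
    using pos by auto
  moreover have "ord (x [^] k) = d"
    using ord_pow[of x k] assms(2) k \<open>k > 0\<close> by simp
  ultimately show thesis
    using that by blast
qed

lemma order_super_power_graph_arcs:
  assumes fin: "finite (carrier G)"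
  shows "parcs (order_super_graph G (power_graph G)) =
    {(g, h). g \<in> carrier G \<and> h \<in> carrier G \<and> g \<noteq> h \<and> (ord g dvd ord h \<or> ord h dvd ord g)}"
proof -
  have "ord (x [^] n) dvd ord x" if "x \<in> carrier G" for x and n :: nat
  proof -
    have "(x [^] n) [^] ord x = \<one>"
      using that by (simp add: nat_pow_pow pow_eq_id)
    then show ?thesis
      using that by (simp add: pow_eq_id)
  qed
  then have dvd: "ord g dvd ord h \<or> ord h dvd ord g" if "(g, h) \<in> parcs (power_graph G)" for g h
    using that by (auto simp: power_graph_def)
  \<comment> \<open>Both orientations are recorded so that the fact also serves with
    \<open>g\<close> and \<open>h\<close> exchanged. Distinct orders ensure that the power of
    \<open>h\<close> found here is not \<open>h\<close> itself; equal orders give an edge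
    directly.\<close>
  have ex: "\<exists>g' \<in> carrier G. \<exists>h' \<in> carrier G. ord g' = ord g \<and> ord h' = ord h \<and>
      (g', h') \<in> parcs (power_graph G) \<and> (h', g') \<in> parcs (power_graph G)"
    if gh: "g \<in> carrier G" "h \<in> carrier G" "ord g dvd ord h" "ord g \<noteq> ord h" for g h
  proof -
    obtain k :: nat where k: "k > 0" "ord (h [^] k) = ord g"
      using ex_pow_of_ord[OF fin gh(2,3)] .
    moreover have "h [^] k \<noteq> h"
      using k gh(4) by auto
    ultimately show ?thesis
      using gh by (intro bexI[of _ "h [^] k"] bexI[of _ h]) (auto simp: power_graph_def)
  qed
  show ?thesis
  proof (intro subset_antisym subsetI; clarify)
    fix g h assume "(g, h) \<in> parcs (order_super_graph G (power_graph G))"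
    then show "g \<in> carrier G \<and> h \<in> carrier G \<and> g \<noteq> h \<and> (ord g dvd ord h \<or> ord h dvd ord g)"
      using dvd by (fastforce simp: order_super_graph_def)
  next
    fix g h assume gh: "g \<in> carrier G" "h \<in> carrier G" "g \<noteq> h" "ord g dvd ord h \<or> ord h dvd ord g"
    then show "(g, h) \<in> parcs (order_super_graph G (power_graph G))"
      using ex[of g h] ex[of h g] by (simp add: order_super_graph_def) metis
  qed
qed

lemma order_super_graphs_eq_iff:
  assumes fin: "finite (carrier G)"
  shows "order_super_graph G (power_graph G) = order_super_graph G (commuting_graph G) \<longleftrightarrow>
    (\<forall>x \<in> carrier G. \<forall>y \<in> carrier G. x \<otimes> y = y \<otimes> x \<longrightarrow> ord x dvd ord y \<or> ord y dvd ord x)"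
    (is "?P = ?D \<longleftrightarrow> ?R")
proof
  assume eq: "?P = ?D"
  show ?R
  proof (intro ballI impI)
    fix x y assume xy: "x \<in> carrier G" "y \<in> carrier G" "x \<otimes> y = y \<otimes> x"
    show "ord x dvd ord y \<or> ord y dvd ord x"
    proof (cases "x = y")
      case False
      then have "(x, y) \<in> parcs ?D"
        using xy by (auto simp: order_super_graph_def commuting_graph_def)
      then show ?thesis
        using order_super_power_graph_arcs[OF fin] unfolding eq[symmetric] by simp
    qed simp
  qed
next
  assume R: ?R
  \<comment> \<open>An element commutes with its powers, so this inclusion holds in every group;
    only the reverse one below relies on \<open>R\<close>.\<close>
  have "parcs (power_graph G) \<subseteq> parcs (commuting_graph G)"
    by (auto simp: power_graph_def commuting_graph_def group_commutes_pow)
  then have "parcs ?P \<subseteq> parcs ?D"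
    by (auto simp: order_super_graph_def)
  moreover have "parcs ?D \<subseteq> parcs ?P"
  proof (intro subsetI; clarify)
    \<comment> \<open>If the orders differ, \<open>R\<close> is applied to the commuting
      representatives, which have the same orders as \<open>g\<close> and \<open>h\<close>.\<close>
    fix g h assume "(g, h) \<in> parcs ?D"
    then show "(g, h) \<in> parcs ?P"
      unfolding order_super_power_graph_arcs[OF fin]
      using R by (fastforce simp: order_super_graph_def commuting_graph_def)
  qed
  ultimately show "?P = ?D"
    by (simp add: order_super_graph_def)
qed

lemma commuting_ord_linear_iff_prime_power:
  assumes fin: "finite (carrier G)"
  shows "(\<forall>x \<in> carrier G. \<forall>y \<in> carrier G. x \<otimes> y = y \<otimes> x \<longrightarrow> ord x dvd ord y \<or> ord y dvd ord x) \<longleftrightarrow>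
    (\<forall>x \<in> carrier G. \<exists>p k. prime p \<and> ord x = p ^ k)" (is "?L \<longleftrightarrow> ?R")
proof
  assume L: ?L
  show ?R
  proof (rule ballI, rule ccontr)
    fix x assume x: "x \<in> carrier G" and "\<nexists>p k. prime p \<and> ord x = p ^ k"
    moreover have "ord x > 0"
      using ord_ge_1[OF fin x] by simp
    ultimately obtain p q where pq: "prime p" "prime q" "p \<noteq> q" "p dvd ord x" "q dvd ord x"
      using not_prime_power_obtain_primes by blast
    obtain i :: nat where i: "ord (x [^] i) = p"
      using ex_pow_of_ord[OF fin x pq(4)] .
    obtain j :: nat where j: "ord (x [^] j) = q"
      using ex_pow_of_ord[OF fin x pq(5)] .
    have "x [^] i \<otimes> x [^] j = x [^] j \<otimes> x [^] i"
      using x by (simp add: nat_pow_mult add.commute)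
    then have "p dvd q \<or> q dvd p"
      using L x i j by (metis nat_pow_closed)
    then show False
      using pq primes_dvd_imp_eq by metis
  qed
next
  assume R: ?R
  show ?L
  proof (intro ballI impI)
    fix x y assume xy: "x \<in> carrier G" "y \<in> carrier G" "x \<otimes> y = y \<otimes> x"
    obtain p a q b where pq: "prime p" "ord x = p ^ a" "prime q" "ord y = q ^ b"
      using R xy by metis
    show "ord x dvd ord y \<or> ord y dvd ord x"
    proof (cases "p = q")
      case True
      then show ?thesis
        using pq le_imp_power_dvd linear by metis
    next
      case False
      then have cop: "coprime (ord x) (ord y)"
        using pq by (simp add: primes_coprime)
      \<comment> \<open>The hypothesis is now used for the product, whose order is a multiple of
        both orders.\<close>
      obtain r k where "prime r" "ord (x \<otimes> y) = r ^ k"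
        using R xy by blast
      moreover have "ord x dvd ord (x \<otimes> y)"
        using ord_dvd_ord_mult_of_coprime xy cop by blast
      moreover have "ord y dvd ord (x \<otimes> y)"
        using ord_dvd_ord_mult_of_coprime[of y x] xy cop by (simp add: coprime_commute)
      ultimately show ?thesis
        using dvd_prime_power_linear by metis
    qed
  qed
qed

text \<open>This turns the quantifier over cyclic subgroups into one over elements. Integer powers
  in \<open>H\<close> agree with those in \<open>G\<close>, so a generator of \<open>H\<close> as a
  group also generates it inside \<open>G\<close>.\<close>

lemma cyclic_subgroup_iff_generate:
  "subgroup H G \<and> cyclic_group (G\<lparr>carrier := H\<rparr>) \<longleftrightarrow> (\<exists>x \<in> carrier G. H = generate G {x})"
proof -
  have "cyclic_group (G\<lparr>carrier := H\<rparr>) \<longleftrightarrow> (\<exists>x \<in> H. H = generate G {x})" if H: "subgroup H G" for H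
  proof -
    interpret H: group "G\<lparr>carrier := H\<rparr>"
      using H subgroup.subgroup_is_group is_group by blast
    have "x \<in> carrier G" if "x \<in> H" for x
      using subgroup.mem_carrier[OF H that] .
    then show ?thesis
      using int_pow_consistent[OF H]
      by (auto simp: H.cyclic_group generate_pow full_SetCompr_eq)
  qed
  then show ?thesis
    using generate_is_subgroup subgroup.mem_carrier generate.incl by (metis empty_subsetI insert_subset singletonI)
qed

end

theorem corollary3p3:
  fixes G :: "('a, 'b) monoid_scheme"
  assumes "group G" and "finite (carrier G)"
  shows "order_super_graph G (power_graph G) = order_super_graph G (commuting_graph G)
    \<longleftrightarrow> (\<forall>H. subgroup H G \<and> cyclic_group (G\<lparr>carrier := H\<rparr>)
          \<longrightarrow> (\<exists>(p::nat) (k::nat). prime p \<and> order (G\<lparr>carrier := H\<rparr>) = p ^ k))"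
proof -
  interpret group G by fact
  show ?thesis
    unfolding order_super_graphs_eq_iff[OF assms(2)]
      commuting_ord_linear_iff_prime_power[OF assms(2)] cyclic_subgroup_iff_generate
    \<comment> \<open>The subgroup generated by \<open>x\<close> has exactly \<open>ord x\<close>
      elements.\<close>
    by (auto simp: order_def generate_pow_card)
qed

end
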